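(* Consider the $n$-body problem in $\mathbb{R}^d$ with masses $m_1,\dots,m_n$, and let $(\rho,\nu,\sigma,\delta)$ be the basis of invariant quadratic forms described in the context. The Poisson structure matrix $B$ for the invariant variables $(\rho,\nu,\sigma,\delta)$ has the block form $$ B=\begin{pmatrix} 0 & 2(L(\sigma)-\Delta) & L(\rho) & v(\rho)\\ \cdot & 0 & -L(\nu) & v(\nu)\\ \cdot & \cdot & \Delta & v(\sigma)\\ \cdot & \cdot & \cdot & \Sigma \end{pmatrix}, $$ where $\Delta=\Delta(\delta)$ and $\Sigma=\Sigma(\delta)$, and all four matrix-valued functions $L,v,\Delta,\Sigma$ are linear in their arguments and have coefficients that are of degree $-1$ in the masses $m_i$. In addition $L$ is symmetric, while $\Delta$ and $\Sigma$ are antisymmetric.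
   Context: Phase space $\mathbb{R}^{2nd}$ has coordinates $(\mathbf{q}_1,\dots,\mathbf{q}_n,\mathbf{v}_1,\dots,\mathbf{v}_n)$ with $\mathbf{q}_i,\mathbf{v}_i\in\mathbb{R}^d$ (positions and velocities), and Poisson bracket $\{(\mathbf{q}_i)_k,(\mathbf{v}_j)_l\}=\delta_{ij}\delta_{kl}/m_j$ (Kronecker deltas), all other brackets of coordinates being zero. The total mass $m_1+\dots+m_n$ is assumed nonzero. Write $\mathbf{q}_{ij}=\mathbf{q}_i-\mathbf{q}_j$ and $\mathbf{v}_{ij}=\mathbf{v}_i-\mathbf{v}_j$. The invariant quadratic forms are the linear combinations of the scalar products $\mathbf{q}_{ij}\cdot\mathbf{q}_{kl}$, $\mathbf{v}_{ij}\cdot\mathbf{v}_{kl}$, $\mathbf{q}_{ij}\cdot\mathbf{v}_{kl}$; they are invariant under translations, Galilean boosts and $O(d)$, they form a vector space of dimension $(2n-1)(n-1)$, and this space is closed under the Poisson bracket. For $1\le i<j\le n$ put $\rho_{ij}=\|\mathbf{q}_{ij}\|^2$, $\nu_{ij}=\|\mathbf{v}_{ij}\|^2$, $\sigma_{ij}=\mathbf{q}_{ij}\cdot\mathbf{v}_{ij}$, and let $\rho,\nu,\sigma$ be the column vectors with these entries (same ordering of pairs in all three). This leaves $(n-1)(n-2)/2$ further invariants needed to complete a basis; $\delta$, with entries $\delta_{ij}$, $i<j<n$, denotes any choice that completes the basis of quadratic invariants. The Poisson structure matrix $B$ is the matrix of pairwise Poisson brackets of the basis elements, expressed linearly in the basis;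 e.g. the block in row $\rho$ and column $\nu$ has entries $\{\rho_{ij},\nu_{kl}\}$. Dots denote blocks determined by antisymmetry of $B$. For $n=2$ the variable $\delta$ and the blocks $v,\Sigma$ are absent and $\Delta=0$; for $n=3$, $\Sigma=0$.
   Formalization: δ is not any completing choice: it is mass-independent and each δ_ij lies in the span of the forms q_ij·v_kl − q_kl·v_ij; otherwise (e.g. δ_12 replaced by δ_12+ρ_12, n≥3) the σσ-block is not a function of δ alone and the claim fails. *)

theory Defs
  imports "HOL-Analysis.Analysis" "HOL-Library.Function_Algebras"
begin

text \<open>Pointwise scalar multiplication, so that \<^const>\<open>span\<close> and \<^const>\<open>independent\<close>
  apply to spaces of functions on phase space.\<close>

instantiation "fun" :: (type, real_vector) real_vector
begin

definition "scaleR c f = (\<lambda>x. c *\<^sub>R f x)"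

instance
  by standard (simp_all add: fun_eq_iff scaleR_fun_def scaleR_add_left scaleR_add_right)

end

text \<open>The bodies are the elements of the finite linearly ordered type \<open>'n\<close> (so \<open>n = CARD('n)\<close>),
  \<open>'d\<close> indexes the coordinates of \<open>\<real>\<^sup>d\<close>, and a point of phase space is the pair of all positions
  and all velocities.\<close>

type_synonym ('d, 'n) phase = "(real^'d^'n) \<times> (real^'d^'n)"

definition poisson ::
  "real^'n \<Rightarrow> (('d::finite, 'n::finite) phase \<Rightarrow> real) \<Rightarrow> (('d, 'n) phase \<Rightarrow> real) \<Rightarrow> ('d, 'n) phase \<Rightarrow> real"
where
  "poisson m f g z =
    (\<Sum>i\<in>UNIV. \<Sum>k\<in>UNIV.
      (frechet_derivative f (at z) (axis i (axis k 1), 0) * frechet_derivative g (at z) (0, axis i (axis k 1))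
     - frechet_derivative f (at z) (0, axis i (axis k 1)) * frechet_derivative g (at z) (axis i (axis k 1), 0))
      / m $ i)"

lemma frechet_derivative_fst_component:
  "frechet_derivative (\<lambda>z :: ('d::finite, 'n::finite) phase. fst z $ i $ k) (at z) = (\<lambda>h. fst h $ i $ k)"
proof -
  have "bounded_linear (\<lambda>h :: ('d, 'n) phase. fst h $ i $ k)"
    by (intro bounded_linear_vec_nth[THEN bounded_linear_compose]
        bounded_linear_vec_nth[THEN bounded_linear_compose] bounded_linear_fst)
  then show ?thesis
    by (intro frechet_derivative_at[symmetric] bounded_linear_imp_has_derivative)
qed

lemma frechet_derivative_snd_component:
  "frechet_derivative (\<lambda>z :: ('d::finite, 'n::finite) phase. snd z $ i $ k) (at z) = (\<lambda>h. snd h $ i $ k)"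
proof -
  have "bounded_linear (\<lambda>h :: ('d, 'n) phase. snd h $ i $ k)"
    by (intro bounded_linear_vec_nth[THEN bounded_linear_compose]
        bounded_linear_vec_nth[THEN bounded_linear_compose] bounded_linear_snd)
  then show ?thesis
    by (intro frechet_derivative_at[symmetric] bounded_linear_imp_has_derivative)
qed

lemma poisson_coordinates:
  fixes z :: "('d::finite, 'n::finite) phase"
  shows "poisson m (\<lambda>z. fst z $ i $ k) (\<lambda>z. snd z $ j $ l) z = (if i = j \<and> k = l then 1 / m $ j else 0)"
    and "poisson m (\<lambda>z. fst z $ i $ k) (\<lambda>z. fst z $ j $ l) z = 0"
    and "poisson m (\<lambda>z. snd z $ i $ k) (\<lambda>z. snd z $ j $ l) z = 0"
proof -
  have "(\<Sum>a\<in>UNIV. \<Sum>b\<in>UNIV.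
      (axis a (axis b 1) :: real^'d^'n) $ i $ k * (axis a (axis b 1) :: real^'d^'n) $ j $ l / m $ a)
    = (\<Sum>a\<in>UNIV. \<Sum>b\<in>UNIV. if a = i then (if b = k then (if i = j \<and> k = l then 1 / m $ j else 0) else 0) else 0)"
    by (intro sum.cong refl) (auto simp: axis_def)
  then show "poisson m (\<lambda>z. fst z $ i $ k) (\<lambda>z. snd z $ j $ l) z = (if i = j \<and> k = l then 1 / m $ j else 0)"
    by (simp add: poisson_def frechet_derivative_fst_component frechet_derivative_snd_component
        sum.If_cases)
qed (simp_all add: poisson_def frechet_derivative_fst_component frechet_derivative_snd_component)

definition qdiff :: "('d, 'n::finite) phase \<Rightarrow> 'n \<Rightarrow> 'n \<Rightarrow> real^'d" where
  "qdiff z i j = fst z $ i - fst z $ j"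

definition vdiff :: "('d, 'n::finite) phase \<Rightarrow> 'n \<Rightarrow> 'n \<Rightarrow> real^'d" where
  "vdiff z i j = snd z $ i - snd z $ j"

definition invariant_forms :: "(('d::finite, 'n::finite) phase \<Rightarrow> real) set" where
  "invariant_forms = span
     ({\<lambda>z. qdiff z i j \<bullet> qdiff z k l | i j k l. True}
    \<union> {\<lambda>z. vdiff z i j \<bullet> vdiff z k l | i j k l. True}
    \<union> {\<lambda>z. qdiff z i j \<bullet> vdiff z k l | i j k l. True})"

text \<open>The mixed invariants whose coefficient matrix is antisymmetric. The mixed invariants with
  symmetric coefficient matrix are spanned by the \<open>\<sigma>\<^sub>i\<^sub>j\<close>, so these are what is left for \<open>\<delta>\<close>.\<close>

definition skew_forms :: "(('d::finite, 'n::finite) phase \<Rightarrow> real) set" where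
  "skew_forms = span {\<lambda>z. qdiff z i j \<bullet> vdiff z k l - qdiff z k l \<bullet> vdiff z i j | i j k l. True}"

definition pairs :: "('n::{finite,linorder} \<times> 'n) set" where
  "pairs = {(i, j). i < j}"

definition pairs' :: "('n::{finite,linorder} \<times> 'n) set" where
  "pairs' = {(i, j). i < j \<and> j < Max UNIV}"

datatype 'p index = Rho 'p | Nu 'p | Sig 'p | Del 'p

definition indices :: "('n::{finite,linorder} \<times> 'n) index set" where
  "indices = Rho ` pairs \<union> Nu ` pairs \<union> Sig ` pairs \<union> Del ` pairs'"

definition rho :: "('d::finite, 'n::finite) phase \<Rightarrow> 'n \<times> 'n \<Rightarrow> real" where
  "rho z = (\<lambda>(i, j). (norm (qdiff z i j))\<^sup>2)"

definition nu :: "('d::finite, 'n::finite) phase \<Rightarrow> 'n \<times> 'n \<Rightarrow> real" where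
  "nu z = (\<lambda>(i, j). (norm (vdiff z i j))\<^sup>2)"

definition sig :: "('d::finite, 'n::finite) phase \<Rightarrow> 'n \<times> 'n \<Rightarrow> real" where
  "sig z = (\<lambda>(i, j). qdiff z i j \<bullet> vdiff z i j)"

fun invariant ::
  "(('d::finite, 'n::finite) phase \<Rightarrow> 'n \<times> 'n \<Rightarrow> real) \<Rightarrow> ('n \<times> 'n) index \<Rightarrow> ('d, 'n) phase \<Rightarrow> real"
where
  "invariant \<delta> (Rho p) = (\<lambda>z. rho z p)"
| "invariant \<delta> (Nu p) = (\<lambda>z. nu z p)"
| "invariant \<delta> (Sig p) = (\<lambda>z. sig z p)"
| "invariant \<delta> (Del p) = (\<lambda>z. \<delta> z p)"

definition completes_basis ::
  "(('d::finite, 'n::{finite,linorder}) phase \<Rightarrow> 'n \<times> 'n \<Rightarrow> real) \<Rightarrow> bool"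
where
  "completes_basis \<delta> \<longleftrightarrow>
     inj_on (invariant \<delta>) indices \<and>
     independent (invariant \<delta> ` indices) \<and>
     span (invariant \<delta> ` indices) = invariant_forms"

text \<open>The requirement \<open>\<delta>\<^sub>p \<in> skew_forms\<close> cannot be dropped: for \<open>n \<ge> 3\<close> the brackets
  \<open>{\<sigma>\<^sub>p, \<sigma>\<^sub>q}\<close> span the skew forms, so the \<open>\<sigma>\<sigma>\<close>-block can be a function of \<open>\<delta>\<close> alone only if
  \<open>\<delta>\<close> is a basis of the skew forms. Replacing \<open>\<delta>\<^sub>1\<^sub>2\<close> by \<open>\<delta>\<^sub>1\<^sub>2 + \<rho>\<^sub>1\<^sub>2\<close> destroys the block form.\<close>

definition admissible_delta ::
  "(('d::finite, 'n::{finite,linorder}) phase \<Rightarrow> 'n \<times> 'n \<Rightarrow> real) \<Rightarrow> bool"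
where
  "admissible_delta \<delta> \<longleftrightarrow>
     completes_basis \<delta> \<and> (\<forall>p\<in>pairs'. (\<lambda>z. \<delta> z p) \<in> skew_forms)"

definition admissible_masses :: "real^'n \<Rightarrow> bool" where
  "admissible_masses m \<longleftrightarrow> (\<forall>i. m $ i \<noteq> 0) \<and> (\<Sum>i\<in>UNIV. m $ i) \<noteq> 0"

definition structure_matrix ::
  "real^'n::{finite,linorder} \<Rightarrow> (('d::finite, 'n) phase \<Rightarrow> 'n \<times> 'n \<Rightarrow> real) \<Rightarrow>
   ('d, 'n) phase \<Rightarrow> ('n \<times> 'n) index \<Rightarrow> ('n \<times> 'n) index \<Rightarrow> real"
where
  "structure_matrix m \<delta> z a b = poisson m (invariant \<delta> a) (invariant \<delta> b) z"

text \<open>Homogeneous Laurent polynomials of degree \<open>k\<close> in the masses.\<close>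

definition mass_homogeneous :: "int \<Rightarrow> (real^'n \<Rightarrow> real) \<Rightarrow> bool" where
  "mass_homogeneous k c \<longleftrightarrow>
     (\<exists>(E :: ('n \<Rightarrow> int) set) a. finite E \<and> (\<forall>e\<in>E. (\<Sum>i\<in>UNIV. e i) = k) \<and>
        (\<forall>m. (\<forall>i. m $ i \<noteq> 0) \<longrightarrow> c m = (\<Sum>e\<in>E. a e * (\<Prod>i\<in>UNIV. m $ i powi e i))))"

text \<open>Vectors and matrices are functions on pairs; only the entries with index in the stated finite
  index sets are meaningful. \<open>F m x\<close> is a matrix with rows \<open>R\<close> and columns \<open>C\<close>, linear in the vector
  \<open>x\<close> with index set \<open>S\<close>, whose coefficients are of degree \<open>-1\<close> in the masses \<open>m\<close>.\<close>

definition linear_matrix ::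
  "'p set \<Rightarrow> 'p set \<Rightarrow> 'p set \<Rightarrow> (real^'n \<Rightarrow> ('p \<Rightarrow> real) \<Rightarrow> 'p \<Rightarrow> 'p \<Rightarrow> real) \<Rightarrow> bool"
where
  "linear_matrix R C S F \<longleftrightarrow>
     (\<exists>c :: real^'n \<Rightarrow> 'p \<Rightarrow> 'p \<Rightarrow> 'p \<Rightarrow> real.
        (\<forall>p\<in>R. \<forall>q\<in>C. \<forall>r\<in>S. mass_homogeneous (-1) (\<lambda>m. c m p q r)) \<and>
        (\<forall>m x. \<forall>p\<in>R. \<forall>q\<in>C. F m x p q = (\<Sum>r\<in>S. c m p q r * x r)))"

definition symmetric_on :: "'p set \<Rightarrow> ('p \<Rightarrow> 'p \<Rightarrow> real) \<Rightarrow> bool" where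
  "symmetric_on R A \<longleftrightarrow> (\<forall>p\<in>R. \<forall>q\<in>R. A q p = A p q)"

definition antisymmetric_on :: "'p set \<Rightarrow> ('p \<Rightarrow> 'p \<Rightarrow> real) \<Rightarrow> bool" where
  "antisymmetric_on R A \<longleftrightarrow> (\<forall>p\<in>R. \<forall>q\<in>R. A q p = - A p q)"

text \<open>The last six equations are the blocks below the diagonal, that is, minus the
  transposes of the blocks above it. \<open>S\<close> is the matrix written \<open>\<Sigma>\<close> in the literature.\<close>

fun block_matrix ::
  "(('p \<Rightarrow> real) \<Rightarrow> 'p \<Rightarrow> 'p \<Rightarrow> real) \<Rightarrow> (('p \<Rightarrow> real) \<Rightarrow> 'p \<Rightarrow> 'p \<Rightarrow> real) \<Rightarrow>
   (('p \<Rightarrow> real) \<Rightarrow> 'p \<Rightarrow> 'p \<Rightarrow> real) \<Rightarrow> (('p \<Rightarrow> real) \<Rightarrow> 'p \<Rightarrow> 'p \<Rightarrow> real) \<Rightarrow>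
   ('p \<Rightarrow> real) \<Rightarrow> ('p \<Rightarrow> real) \<Rightarrow> ('p \<Rightarrow> real) \<Rightarrow> ('p \<Rightarrow> real) \<Rightarrow>
   'p index \<Rightarrow> 'p index \<Rightarrow> real"
where
  "block_matrix L v \<Delta> S \<rho> \<nu> \<sigma> \<delta> (Rho p) (Rho q) = 0"
| "block_matrix L v \<Delta> S \<rho> \<nu> \<sigma> \<delta> (Rho p) (Nu q) = 2 * (L \<sigma> p q - \<Delta> \<delta> p q)"
| "block_matrix L v \<Delta> S \<rho> \<nu> \<sigma> \<delta> (Rho p) (Sig q) = L \<rho> p q"
| "block_matrix L v \<Delta> S \<rho> \<nu> \<sigma> \<delta> (Rho p) (Del q) = v \<rho> p q"
| "block_matrix L v \<Delta> S \<rho> \<nu> \<sigma> \<delta> (Nu p) (Nu q) = 0"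
| "block_matrix L v \<Delta> S \<rho> \<nu> \<sigma> \<delta> (Nu p) (Sig q) = - L \<nu> p q"
| "block_matrix L v \<Delta> S \<rho> \<nu> \<sigma> \<delta> (Nu p) (Del q) = v \<nu> p q"
| "block_matrix L v \<Delta> S \<rho> \<nu> \<sigma> \<delta> (Sig p) (Sig q) = \<Delta> \<delta> p q"
| "block_matrix L v \<Delta> S \<rho> \<nu> \<sigma> \<delta> (Sig p) (Del q) = v \<sigma> p q"
| "block_matrix L v \<Delta> S \<rho> \<nu> \<sigma> \<delta> (Del p) (Del q) = S \<delta> p q"
| "block_matrix L v \<Delta> S \<rho> \<nu> \<sigma> \<delta> (Nu p) (Rho q) = - (2 * (L \<sigma> q p - \<Delta> \<delta> q p))"
| "block_matrix L v \<Delta> S \<rho> \<nu> \<sigma> \<delta> (Sig p) (Rho q) = - L \<rho> q p"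
| "block_matrix L v \<Delta> S \<rho> \<nu> \<sigma> \<delta> (Del p) (Rho q) = - v \<rho> q p"
| "block_matrix L v \<Delta> S \<rho> \<nu> \<sigma> \<delta> (Sig p) (Nu q) = L \<nu> q p"
| "block_matrix L v \<Delta> S \<rho> \<nu> \<sigma> \<delta> (Del p) (Nu q) = - v \<nu> q p"
| "block_matrix L v \<Delta> S \<rho> \<nu> \<sigma> \<delta> (Del p) (Sig q) = - v \<sigma> q p"

end

theory Submission
  imports Defs
begin

text \<open>Reading positions and velocities as matrices with one row per body, every invariant form is
  \<open>x \<bullet> (A ** y)\<close> for a matrix \<open>A\<close> with vanishing row sums, and each bracket is again such a form,
  with matrices \<open>A D B\<close> where \<open>D = diag (1 / m\<^sub>i)\<close>. For the rank one matrices \<open>E\<^sub>p\<close> of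
  \<open>\<rho>\<^sub>p, \<nu>\<^sub>p, \<sigma>\<^sub>p\<close> and the skew matrices \<open>W\<^sub>p\<close> of \<open>\<delta>\<^sub>p\<close>, the entries of
  \<open>L, v, \<Delta>, \<Sigma>\<close> come from
  \<open>E\<^sub>p D E\<^sub>q + E\<^sub>q D E\<^sub>p\<close>, \<open>W\<^sub>q D E\<^sub>p - E\<^sub>p D W\<^sub>q\<close>,
  \<open>E\<^sub>q D E\<^sub>p - E\<^sub>p D E\<^sub>q\<close>, \<open>W\<^sub>q D W\<^sub>p - W\<^sub>p D W\<^sub>q\<close>. The first two are
  symmetric, so their forms expand in \<open>\<rho>\<close>, \<open>\<nu>\<close> or \<open>\<sigma>\<close>; the other two are skew and expand in
  \<open>\<delta>\<close>. Since \<open>D\<close> enters linearly, all coefficients have degree \<open>-1\<close> in the masses.\<close>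

section \<open>Bilinear forms on configurations\<close>

type_synonym 'n square_matrix = "real^'n^'n"

type_synonym ('d, 'n) configuration = "real^'d^'n"

definition outer_product :: "real^'n \<Rightarrow> real^'m \<Rightarrow> real^'m^'n" where
  "outer_product u w = (\<chi> a b. u $ a * w $ b)"

text \<open>Signed incidence vector of the edge between \<open>i\<close> and \<open>j\<close>:
  pairing a configuration with it gives the difference of rows \<open>i\<close> and
  \<open>j\<close>.\<close>

definition edge :: "'n \<Rightarrow> 'n \<Rightarrow> real^'n::finite" where
  "edge i j = axis i 1 - axis j 1"

text \<open>Laplacian of the graph whose only edge is \<open>p\<close>.\<close>

definition edge_matrix :: "'n \<times> 'n \<Rightarrow> real^'n::finite^'n" where
  "edge_matrix p = outer_product (edge (fst p) (snd p)) (edge (fst p) (snd p))"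

lemma matrix_mult_row:
  fixes A :: "real^'n::finite^'m" and y :: "real^'d^'n"
  shows "(A ** y) $ a = (\<Sum>b\<in>UNIV. A $ a $ b *\<^sub>R y $ b)"
  by (simp add: vec_eq_iff matrix_matrix_mult_def)

text \<open>This is the trace of x^T A y: matrices act on the body index only, so the dimension of
  space enters just through scalar products of rows.\<close>

lemma inner_matrix_mult:
  fixes A :: "real^'n::finite^'m::finite" and x :: "real^'d::finite^'m" and y :: "real^'d^'n"
  shows "x \<bullet> (A ** y) = (\<Sum>a\<in>UNIV. \<Sum>b\<in>UNIV. A $ a $ b * (x $ a \<bullet> y $ b))"
  by (simp add: inner_vec_def[of x] matrix_mult_row inner_sum_right)

lemma inner_matrix_mult_transpose:
  fixes A :: "real^'n::finite^'m::finite" and x :: "real^'d::finite^'m" and y :: "real^'d^'n"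
  shows "(A ** y) \<bullet> x = y \<bullet> (transpose A ** x)"
  unfolding inner_commute[of "A ** y"] inner_matrix_mult
  by (subst sum.swap) (simp add: transpose_def inner_commute)

lemma inner_outer_product:
  fixes x :: "real^'d::finite^'m::finite" and y :: "real^'d^'n::finite"
  shows "x \<bullet> (outer_product u w ** y) =
    (\<Sum>a\<in>UNIV. u $ a *\<^sub>R x $ a) \<bullet> (\<Sum>b\<in>UNIV. w $ b *\<^sub>R y $ b)"
  unfolding inner_matrix_mult
  by (subst sum.swap)
    (simp add: outer_product_def inner_sum_left inner_sum_right sum_distrib_left mult_ac)

lemma sum_edge:
  fixes x :: "real^'d^'n::finite"
  shows "(\<Sum>a\<in>UNIV. edge i j $ a *\<^sub>R x $ a) = x $ i - x $ j"
proof -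
  have "(\<Sum>a\<in>UNIV. axis k (1::real) $ a *\<^sub>R x $ a) = x $ k" for k
    by (simp add: axis_def if_distrib[of "\<lambda>c. c *\<^sub>R _"] cong: if_cong)
  then show ?thesis
    by (simp add: edge_def scaleR_diff_left sum_subtractf)
qed

lemma inner_outer_product_edge:
  fixes x y :: "real^'d::finite^'n::finite"
  shows "x \<bullet> (outer_product (edge i j) (edge k l) ** y) = (x $ i - x $ j) \<bullet> (y $ k - y $ l)"
  by (simp add: inner_outer_product sum_edge)

lemma transpose_outer_product: "transpose (outer_product u w) = outer_product w u"
  by (simp add: vec_eq_iff outer_product_def transpose_def)

text \<open>The entries of an edge vector add up to 0. For coefficient matrices, annihilating
  \<open>1\<close> expresses invariance under a common shift of all bodies.\<close>

lemma outer_product_edge_one: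
  fixes k l :: "'n::finite"
  shows "outer_product u (edge k l) *v 1 = 0"
proof -
  have "(\<Sum>b\<in>UNIV. axis k (1::real) $ b) = 1" for k :: 'n
    by (simp add: axis_def)
  then show ?thesis
    by (simp add: vec_eq_iff outer_product_def matrix_vector_mult_def edge_def
        sum_distrib_left[symmetric] sum_subtractf)
qed

lemma transpose_edge_matrix [simp]: "transpose (edge_matrix p) = edge_matrix p"
  by (simp add: edge_matrix_def transpose_outer_product)

lemma edge_matrix_one [simp]: "edge_matrix p *v 1 = 0"
  by (simp add: edge_matrix_def outer_product_edge_one)

section \<open>Transposes and bilinearity of the matrix product\<close>

lemma transpose_add: "transpose (A + B) = transpose A + transpose (B :: 'a::plus^'n^'m)"
  by (simp add: vec_eq_iff transpose_def)

lemma transpose_diff: "transpose (A - B) = transpose A - transpose (B :: 'a::minus^'n^'m)"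
  by (simp add: vec_eq_iff transpose_def)

lemma matrix_mult_minus_left: "(- A) ** B = - (A ** B :: real^'n^'m)"
  by (simp add: vec_eq_iff matrix_matrix_mult_def sum_negf)

lemma matrix_mult_minus_right: "A ** (- B) = - (A ** B :: real^'n^'m)"
  by (simp add: vec_eq_iff matrix_matrix_mult_def sum_negf)

lemma matrix_mult_diff_left: "(A - B) ** C = A ** C - (B ** C :: real^'n^'m)"
  by (simp add: vec_eq_iff matrix_matrix_mult_def sum_subtractf left_diff_distrib)

lemma matrix_mult_add_left: "(A + B) ** C = A ** C + (B ** C :: real^'n^'m)"
  by (simp add: vec_eq_iff matrix_matrix_mult_def sum.distrib distrib_right)

lemma matrix_mult_add_right: "C ** (A + B) = C ** A + (C ** B :: real^'n^'m)"
  by (simp add: vec_eq_iff matrix_matrix_mult_def sum.distrib distrib_left)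

lemma matrix_mult_scaleR_left: "(c *\<^sub>R A) ** B = c *\<^sub>R (A ** B :: real^'n^'m)"
  by (simp add: vec_eq_iff matrix_matrix_mult_def sum_distrib_left mult.assoc)

lemma matrix_mult_scaleR_right: "A ** (c *\<^sub>R B) = c *\<^sub>R (A ** B :: real^'n^'m)"
  by (simp add: vec_eq_iff matrix_matrix_mult_def sum_distrib_left mult_ac)

section \<open>Poisson brackets of quadratic forms\<close>

text \<open>The matrix D of the overview: the position-velocity block of the Poisson tensor, acting
  on the body index.\<close>

definition mass_inverse :: "real^'n \<Rightarrow> real^'n^'n" where
  "mass_inverse m = (\<chi> i j. if i = j then 1 / m $ i else 0)"

lemma transpose_mass_inverse [simp]: "transpose (mass_inverse m) = mass_inverse m"
  by (auto simp: vec_eq_iff transpose_def mass_inverse_def)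

lemma mass_inverse_mult_row:
  fixes y :: "real^'d^'n::finite"
  shows "(mass_inverse m ** y) $ i = (1 / m $ i) *\<^sub>R y $ i"
  by (simp add: matrix_mult_row mass_inverse_def if_distrib[of "\<lambda>c. c *\<^sub>R _"] cong: if_cong)

text \<open>Derivatives along coordinate vectors are the gradient components, and dividing by
  \<open>m $ i\<close> is multiplying by \<open>mass_inverse m\<close>.\<close>

lemma poisson_gradient:
  fixes f g :: "('d::finite, 'n::finite) phase \<Rightarrow> real"
  assumes "(f has_derivative (\<lambda>h. fq \<bullet> fst h + fv \<bullet> snd h)) (at z)"
    and "(g has_derivative (\<lambda>h. gq \<bullet> fst h + gv \<bullet> snd h)) (at z)"
  shows "poisson m f g z = fq \<bullet> (mass_inverse m ** gv) - fv \<bullet> (mass_inverse m ** gq)"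
proof -
  have "poisson m f g z =
      (\<Sum>i\<in>UNIV. \<Sum>k\<in>UNIV. (fq $ i $ k * gv $ i $ k - fv $ i $ k * gq $ i $ k) / m $ i)"
    unfolding poisson_def frechet_derivative_at[OF assms(1), symmetric]
      frechet_derivative_at[OF assms(2), symmetric]
    by (simp add: inner_axis)
  also have "\<dots> = fq \<bullet> (mass_inverse m ** gv) - fv \<bullet> (mass_inverse m ** gq)"
    by (simp add: inner_vec_def mass_inverse_mult_row sum_subtractf[symmetric]
        sum_divide_distrib diff_divide_distrib)
  finally show ?thesis .
qed

lemma poisson_skew: "poisson m g f z = - poisson m f g z"
  unfolding poisson_def sum_negf[symmetric] by (intro sum.cong refl)
    (simp add: minus_divide_left mult.commute del: divide_minus_left)

section \<open>Gradients of position, velocity and mixed forms\<close>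

lemma has_derivative_matrix_mult:
  fixes A :: "real^'n::finite^'m::finite" and f :: "_ \<Rightarrow> real^'d::finite^'n"
  assumes "(f has_derivative f') F"
  shows "((\<lambda>z. A ** f z) has_derivative (\<lambda>h. A ** f' h)) F"
proof -
  have "linear (\<lambda>y :: real^'d^'n. A ** y)"
    by (intro linearI) (simp_all add: matrix_mult_add_right matrix_mult_scaleR_right)
  then show ?thesis
    using bounded_linear.has_derivative[OF _ assms] by (simp add: linear_conv_bounded_linear)
qed

context
  fixes z :: "('d::finite, 'n::finite) phase" and A :: "real^'n^'n"
begin

text \<open>The zero summand brings the derivative into the shape that
  \<open>poisson_gradient\<close> expects.\<close>

lemma has_derivative_position_form:
  "((\<lambda>z. fst z \<bullet> (A ** fst z)) has_derivative
    (\<lambda>h. ((A + transpose A) ** fst z) \<bullet> fst h + 0 \<bullet> snd h)) (at z)"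
  by (rule has_derivative_eq_rhs, rule has_derivative_inner,
      (rule has_derivative_matrix_mult has_derivative_fst has_derivative_snd has_derivative_ident)+)
    (simp add: fun_eq_iff matrix_mult_add_left inner_add_left
      inner_matrix_mult_transpose[of "transpose A" "fst z"] inner_commute[of "A ** fst z"])

lemma has_derivative_velocity_form:
  "((\<lambda>z. snd z \<bullet> (A ** snd z)) has_derivative
    (\<lambda>h. 0 \<bullet> fst h + ((A + transpose A) ** snd z) \<bullet> snd h)) (at z)"
  by (rule has_derivative_eq_rhs, rule has_derivative_inner,
      (rule has_derivative_matrix_mult has_derivative_fst has_derivative_snd has_derivative_ident)+)
    (simp add: fun_eq_iff matrix_mult_add_left inner_add_left
      inner_matrix_mult_transpose[of "transpose A" "snd z"] inner_commute[of "A ** snd z"])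

lemma has_derivative_mixed_form:
  "((\<lambda>z. fst z \<bullet> (A ** snd z)) has_derivative
    (\<lambda>h. (A ** snd z) \<bullet> fst h + (transpose A ** fst z) \<bullet> snd h)) (at z)"
  by (rule has_derivative_eq_rhs, rule has_derivative_inner,
      (rule has_derivative_matrix_mult has_derivative_fst has_derivative_snd has_derivative_ident)+)
    (simp add: fun_eq_iff inner_matrix_mult_transpose[of "transpose A" "fst z"]
      inner_commute[of "A ** snd z"])

end

section \<open>Brackets between the three kinds of forms\<close>

context
  fixes z :: "('d::finite, 'n::finite) phase" and A B :: "real^'n^'n" and m :: "real^'n"
begin

lemma poisson_position_position:
  "poisson m (\<lambda>z. fst z \<bullet> (A ** fst z)) (\<lambda>z. fst z \<bullet> (B ** fst z)) z = 0"
  by (subst poisson_gradient[OF has_derivative_position_form has_derivative_position_form]) simp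

lemma poisson_velocity_velocity:
  "poisson m (\<lambda>z. snd z \<bullet> (A ** snd z)) (\<lambda>z. snd z \<bullet> (B ** snd z)) z = 0"
  by (subst poisson_gradient[OF has_derivative_velocity_form has_derivative_velocity_form]) simp

text \<open>Both gradients double by symmetry of \<open>A\<close> and \<open>B\<close>, whence the
  factor 4. The resulting matrix is in general neither symmetric nor skew.\<close>

lemma poisson_position_velocity:
  assumes "transpose A = A" "transpose B = B"
  shows "poisson m (\<lambda>z. fst z \<bullet> (A ** fst z)) (\<lambda>z. snd z \<bullet> (B ** snd z)) z =
    4 * (fst z \<bullet> ((A ** mass_inverse m ** B) ** snd z))"
  using assms
  by (subst poisson_gradient[OF has_derivative_position_form has_derivative_velocity_form])
    (simp only: matrix_mult_add_left matrix_mult_add_right inner_add_left inner_add_right,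
      simp add: inner_matrix_mult_transpose matrix_mul_assoc)

text \<open>The gradients give twice the form of \<open>A ** mass_inverse m ** transpose B\<close>.
  A matrix and its transpose have the same quadratic form, so their sum may be used instead; it is
  symmetric, as the expansion in \<rho> requires.\<close>

lemma poisson_position_mixed:
  assumes "transpose A = A"
  shows "poisson m (\<lambda>z. fst z \<bullet> (A ** fst z)) (\<lambda>z. fst z \<bullet> (B ** snd z)) z =
    fst z \<bullet> ((A ** mass_inverse m ** transpose B + B ** mass_inverse m ** A) ** fst z)"
proof -
  let ?D = "mass_inverse m"
  have "fst z \<bullet> ((A ** ?D ** transpose B) ** fst z) = fst z \<bullet> ((B ** ?D ** A) ** fst z)"
    using inner_matrix_mult_transpose[of "B ** ?D ** A" "fst z" "fst z"] assms
    by (simp add: inner_commute matrix_transpose_mul matrix_mul_assoc)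
  then show ?thesis
    using assms
    by (subst poisson_gradient[OF has_derivative_position_form has_derivative_mixed_form])
      (simp only: matrix_mult_add_left matrix_mult_add_right inner_add_left inner_add_right,
        simp add: inner_matrix_mult_transpose matrix_mul_assoc)
qed

lemma poisson_velocity_mixed:
  assumes "transpose A = A"
  shows "poisson m (\<lambda>z. snd z \<bullet> (A ** snd z)) (\<lambda>z. fst z \<bullet> (B ** snd z)) z =
    - (snd z \<bullet> ((A ** mass_inverse m ** B + transpose B ** mass_inverse m ** A) ** snd z))"
proof -
  let ?D = "mass_inverse m"
  have "snd z \<bullet> ((A ** ?D ** B) ** snd z) = snd z \<bullet> ((transpose B ** ?D ** A) ** snd z)"
    using inner_matrix_mult_transpose[of "A ** ?D ** B" "snd z" "snd z"] assms
    by (simp add: inner_commute matrix_transpose_mul matrix_mul_assoc)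
  then show ?thesis
    using assms
    by (subst poisson_gradient[OF has_derivative_velocity_form has_derivative_mixed_form])
      (simp only: matrix_mult_add_left matrix_mult_add_right inner_add_left inner_add_right,
        simp add: inner_matrix_mult_transpose matrix_mul_assoc)
qed

text \<open>A commutator twisted by \<open>mass_inverse m\<close>. It is skew if \<open>A\<close>
  and \<open>B\<close> are both symmetric or both skew, and symmetric if there is one of each
  type.\<close>

lemma poisson_mixed_mixed:
  "poisson m (\<lambda>z. fst z \<bullet> (A ** snd z)) (\<lambda>z. fst z \<bullet> (B ** snd z)) z =
    fst z \<bullet> ((B ** mass_inverse m ** A - A ** mass_inverse m ** B) ** snd z)"
proof -
  let ?D = "mass_inverse m"
  have "(A ** snd z) \<bullet> (?D ** (transpose B ** fst z)) = fst z \<bullet> ((B ** ?D ** A) ** snd z)"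
    using inner_matrix_mult_transpose[of "?D ** transpose B" "fst z" "A ** snd z"]
    by (simp add: inner_commute matrix_transpose_mul matrix_mul_assoc)
  then show ?thesis
    by (subst poisson_gradient[OF has_derivative_mixed_form has_derivative_mixed_form])
      (simp add: inner_matrix_mult_transpose[of "transpose A"] matrix_mult_diff_left
        inner_diff_right matrix_mul_assoc)
qed

end

section \<open>Expansion in the invariants\<close>

text \<open>A symmetric matrix with zero row sums is a weighted graph Laplacian with edge weights
  \<open>- A $ i $ j\<close>. When the differences are multiplied out over all ordered pairs, terms
  with equal indices cancel by the row sums and the cross terms give
  \<open>- 2 * (x \<bullet> (A ** y))\<close>.\<close>

lemma inner_symmetric_expansion:
  fixes A :: "'n::{finite,linorder} square_matrix" and x y :: "('d::finite, 'n) configuration"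
  assumes "transpose A = A" "A *v 1 = 0"
  shows "x \<bullet> (A ** y) =
    (\<Sum>(i, j)\<in>pairs. - A $ i $ j * ((x $ i - x $ j) \<bullet> (y $ i - y $ j)))"
proof -
  have sym: "A $ j $ i = A $ i $ j" for i j
    using arg_cong[OF assms(1), of "\<lambda>M. M $ i $ j"] by (simp add: transpose_def)
  have row: "(\<Sum>j\<in>UNIV. A $ i $ j) = 0" for i
    using assms(2) by (simp add: vec_eq_iff matrix_vector_mult_def)
  define g where "g = (\<lambda>(i, j). A $ i $ j * ((x $ i - x $ j) \<bullet> (y $ i - y $ j)))"
  have g_swap: "g (j, i) = g (i, j)" for i j
    by (simp add: g_def sym[of i j] inner_diff_left inner_diff_right)
  have diag: "(\<Sum>i\<in>UNIV. \<Sum>j\<in>UNIV. A $ i $ j * (x $ i \<bullet> y $ i)) = 0"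
    by (simp add: sum_distrib_right[symmetric] row)
  have diag': "(\<Sum>i\<in>UNIV. \<Sum>j\<in>UNIV. A $ i $ j * (x $ j \<bullet> y $ j)) = 0"
    by (subst sum.swap, subst sym) (rule diag)
  have cross: "(\<Sum>i\<in>UNIV. \<Sum>j\<in>UNIV. A $ i $ j * (x $ j \<bullet> y $ i)) = x \<bullet> (A ** y)"
    unfolding inner_matrix_mult by (subst sum.swap, subst sym) (rule refl)
  have "(\<Sum>p\<in>UNIV. g p) = (\<Sum>i\<in>UNIV. \<Sum>j\<in>UNIV. g (i, j))"
    unfolding UNIV_Times_UNIV[symmetric] by (rule sum.cartesian_product'[unfolded split_def, simplified])
  also have "\<dots> = - 2 * (x \<bullet> (A ** y))"
    using diag diag' cross
    by (simp add: g_def inner_diff_left inner_diff_right algebra_simps sum.distrib sum_subtractf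
        inner_matrix_mult)
  finally have total: "(\<Sum>p\<in>UNIV. g p) = - 2 * (x \<bullet> (A ** y))" .
  \<comment> \<open>The summand \<open>g\<close> is symmetric and vanishes on the diagonal, so the
    total is twice the sum over \<open>pairs\<close>, which cancels the factor 2.\<close>
  have split: "(UNIV :: ('n \<times> 'n) set) = pairs \<union> (prod.swap ` pairs \<union> {(i, j). i = j})"
  proof (intro equalityI subsetI)
    fix p :: "'n \<times> 'n"
    obtain i j where "p = (i, j)" by force
    then show "p \<in> pairs \<union> (prod.swap ` pairs \<union> {(i, j). i = j})"
      by (cases i j rule: linorder_cases) (auto simp: pairs_def image_iff)
  qed simp
  have "(\<Sum>p\<in>UNIV. g p) = sum g pairs + (sum g (prod.swap ` pairs) + sum g {(i, j). i = j})"
    unfolding split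
    by (subst sum.union_disjoint; (subst sum.union_disjoint)?) (auto simp: pairs_def)
  also have "sum g {(i, j). i = j} = 0"
    by (intro sum.neutral) (auto simp: g_def)
  also have "sum g (prod.swap ` pairs) = sum g pairs"
    by (subst sum.reindex) (auto simp: g_swap intro!: sum.cong)
  finally have "x \<bullet> (A ** y) = - sum g pairs"
    using total by simp
  then show ?thesis
    by (simp add: g_def sum_negf[symmetric] split_def)
qed

lemma sum_fun_apply: "(\<Sum>i\<in>I. f i) x = (\<Sum>i\<in>I. f i x :: real)"
  by (induction I rule: infinite_finite_induct) simp_all

text \<open>Zero row and column sums allow positions and velocities to be measured from one
  arbitrary body \<open>b\<close>, which leaves a combination of generators.\<close>

lemma mixed_form_invariant:
  fixes A :: "'n::finite square_matrix"
  assumes "A *v 1 = 0" "transpose A *v 1 = 0"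
  shows "(\<lambda>z :: ('d::finite, 'n) phase. fst z \<bullet> (A ** snd z)) \<in> invariant_forms"
proof -
  fix b :: 'n
  have row: "(\<Sum>j\<in>UNIV. A $ i $ j) = 0" and col: "(\<Sum>j\<in>UNIV. A $ j $ i) = 0" for i
    using assms by (simp_all add: vec_eq_iff matrix_vector_mult_def transpose_def)
  have "(\<Sum>i\<in>UNIV. \<Sum>j\<in>UNIV. A $ i $ j * (x $ i \<bullet> y $ b)) = 0" for x y :: "('d, 'n) configuration"
    by (simp add: sum_distrib_right[symmetric] row)
  moreover have "(\<Sum>i\<in>UNIV. \<Sum>j\<in>UNIV. A $ i $ j * (x $ b \<bullet> y $ j)) = 0" for x y :: "('d, 'n) configuration"
    by (subst sum.swap) (simp add: sum_distrib_right[symmetric] col)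
  moreover have "(\<Sum>i\<in>UNIV. \<Sum>j\<in>UNIV. A $ i $ j * (x $ b \<bullet> y $ b)) = 0" for x y :: "('d, 'n) configuration"
    by (simp add: sum_distrib_right[symmetric] row)
  ultimately have "fst z \<bullet> (A ** snd z) =
      (\<Sum>i\<in>UNIV. \<Sum>j\<in>UNIV. A $ i $ j * (qdiff z i b \<bullet> vdiff z j b))" for z :: "('d, 'n) phase"
    by (simp add: inner_matrix_mult qdiff_def vdiff_def inner_diff_left inner_diff_right
        right_diff_distrib sum_subtractf)
  then have eq: "(\<lambda>z :: ('d, 'n) phase. fst z \<bullet> (A ** snd z)) =
      (\<Sum>i\<in>UNIV. \<Sum>j\<in>UNIV. A $ i $ j *\<^sub>R (\<lambda>z. qdiff z i b \<bullet> vdiff z j b))"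
    by (simp add: fun_eq_iff sum_fun_apply scaleR_fun_def)
  show ?thesis
    unfolding eq invariant_forms_def by (intro span_sum span_scale span_base) blast
qed

text \<open>A generator has the matrix u w^T - w u^T with edge vectors u and w; skewness and zero
  row sums pass to linear combinations.\<close>

lemma skew_form_matrix:
  fixes f :: "('d::finite, 'n::finite) phase \<Rightarrow> real"
  assumes "f \<in> skew_forms"
  shows "\<exists>W. transpose W = - W \<and> W *v 1 = 0 \<and> f = (\<lambda>z. fst z \<bullet> (W ** snd z))"
  using assms unfolding skew_forms_def
proof (induction rule: span_induct_alt)
  case base
  show ?case
    by (intro exI[of _ 0]) (simp add: fun_eq_iff vec_eq_iff transpose_def matrix_vector_mult_def
        inner_matrix_mult)
next
  case (step c g f)
  then obtain W i j k l where W: "transpose W = - W" "W *v 1 = 0" "f = (\<lambda>z. fst z \<bullet> (W ** snd z))"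
    and g: "g = (\<lambda>z. qdiff z i j \<bullet> vdiff z k l - qdiff z k l \<bullet> vdiff z i j)"
    by blast
  define G :: "'n square_matrix" where
    "G = outer_product (edge i j) (edge k l) - outer_product (edge k l) (edge i j)"
  have "transpose G = - G" "G *v 1 = 0"
    by (simp_all add: G_def transpose_diff transpose_outer_product outer_product_edge_one
        matrix_vector_mult_diff_rdistrib)
  moreover have "g = (\<lambda>z. fst z \<bullet> (G ** snd z))"
    by (simp add: g G_def matrix_mult_diff_left inner_diff_right inner_outer_product_edge
        qdiff_def vdiff_def fun_eq_iff)
  ultimately show ?case
    using W
    by (intro exI[of _ "c *\<^sub>R G + W"])
      (simp add: transpose_add fun_eq_iff matrix_mult_add_left inner_add_right
        matrix_mult_scaleR_left matrix_vector_mult_add_rdistrib transpose_scalar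
        scaleR_fun_def scaleR_matrix_vector_assoc[symmetric])
qed

context
  fixes \<delta> :: "('d::finite, 'n::{finite,linorder}) phase \<Rightarrow> 'n \<times> 'n \<Rightarrow> real"
  assumes adm: "admissible_delta \<delta>"
begin

text \<open>Antisymmetrising a form under the sign change of the velocities and under the exchange of
  positions and velocities annihilates \<open>\<rho>\<close>, \<open>\<nu>\<close>, \<open>\<sigma>\<close> and is \<open>4\<close> times the identity on
  skew forms, so a skew form involves only the \<open>\<delta>\<close> of the basis.\<close>

lemma skew_form_in_delta:
  fixes A :: "'n square_matrix"
  assumes "transpose A = - A" "A *v 1 = 0"
  shows "\<exists>c. \<forall>z. fst z \<bullet> (A ** snd z) = (\<Sum>p\<in>pairs'. c p * \<delta> z p)"
proof -
  \<comment> \<open>First f(q,v) - f(q,-v) kills \<rho> and \<nu> and doubles mixed forms; then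
    f(q,v) - f(v,q) kills \<sigma> and doubles the skew ones. \<open>T\<close> is the composite,
    hence the 4.\<close>
  define T :: "(('d, 'n) phase \<Rightarrow> real) \<Rightarrow> ('d, 'n) phase \<Rightarrow> real" where
    "T f z = f z - f (fst z, - snd z) - f (snd z, fst z) + f (snd z, - fst z)" for f z
  have T_skew: "T (\<lambda>z. fst z \<bullet> (W ** snd z)) z = 4 * (fst z \<bullet> (W ** snd z))"
    if "transpose W = - W" for W z
    using inner_matrix_mult_transpose[of W "fst z" "snd z"] that
    by (simp add: T_def matrix_mult_minus_left matrix_mult_minus_right inner_commute)
  have T_delta: "T (\<lambda>z. \<delta> z p) z = 4 * \<delta> z p" if "p \<in> pairs'" for p z
  proof -
    have "(\<lambda>z. \<delta> z p) \<in> skew_forms"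
      using adm that by (simp add: admissible_delta_def)
    from skew_form_matrix[OF this] obtain W where W: "transpose W = - W"
      "(\<lambda>z. \<delta> z p) = (\<lambda>z. fst z \<bullet> (W ** snd z))"
      by (elim exE conjE)
    show ?thesis
      unfolding W(2) using T_skew[OF W(1)] fun_cong[OF W(2)] by simp
  qed
  have other: "T (\<lambda>z. rho z p) z = 0" "T (\<lambda>z. nu z p) z = 0" "T (\<lambda>z. sig z p) z = 0" for p z
    by (cases p; simp add: T_def rho_def nu_def sig_def qdiff_def vdiff_def power2_norm_eq_inner
        inner_diff_left inner_diff_right inner_commute)+
  have expansion: "\<exists>c. \<forall>z. T f z = (\<Sum>p\<in>pairs'. c p * \<delta> z p)" if "f \<in> span (invariant \<delta> ` indices)" for f
    using that
  proof (induction rule: span_induct_alt)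
    case base
    show ?case by (intro exI[of _ "\<lambda>_. 0"]) (simp add: T_def)
  next
    case (step a g f)
    then obtain c where c: "\<And>z. T f z = (\<Sum>p\<in>pairs'. c p * \<delta> z p)"
      by blast
    have "\<exists>d. \<forall>z. T g z = (\<Sum>p\<in>pairs'. d p * \<delta> z p)"
    proof (cases "\<exists>p\<in>pairs'. g = (\<lambda>z. \<delta> z p)")
      case True
      then obtain p where p: "p \<in> pairs'" "g = (\<lambda>z. \<delta> z p)" by blast
      show ?thesis
        using p T_delta[OF p(1)]
        by (intro exI[of _ "\<lambda>q. if q = p then 4 else 0"])
          (simp add: if_distrib[of "\<lambda>c. c * _"] cong: if_cong)
    next
      case False
      then have "\<forall>z. T g z = 0"
        using step(1) by (auto simp: indices_def other)
      then show ?thesis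
        by (intro exI[of _ "\<lambda>_. 0"]) simp
    qed
    then obtain d where d: "\<And>z. T g z = (\<Sum>p\<in>pairs'. d p * \<delta> z p)" by blast
    have "T (a *\<^sub>R g + f) z = a * T g z + T f z" for z
      by (simp add: T_def scaleR_fun_def algebra_simps)
    then have combination: "T (a *\<^sub>R g + f) z = (\<Sum>p\<in>pairs'. (a * d p + c p) * \<delta> z p)" for z
      by (simp add: c d distrib_right sum.distrib sum_distrib_left mult.assoc)
    show ?case
      by (intro exI[of _ "\<lambda>p. a * d p + c p"] allI combination)
  qed
  have "transpose A *v 1 = 0"
    using assms by (simp add: vec_eq_iff matrix_vector_mult_def sum_negf)
  then have "(\<lambda>z. fst z \<bullet> (A ** snd z)) \<in> span (invariant \<delta> ` indices)"
    using mixed_form_invariant[of A] assms adm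
    by (simp add: admissible_delta_def completes_basis_def)
  from expansion[OF this] obtain c
    where "\<forall>z. T (\<lambda>z. fst z \<bullet> (A ** snd z)) z = (\<Sum>p\<in>pairs'. c p * \<delta> z p)"
    by (elim exE)
  then have "4 * (fst z \<bullet> (A ** snd z)) = (\<Sum>p\<in>pairs'. c p * \<delta> z p)" for z
    unfolding T_skew[OF assms(1)] by (rule spec)
  then show ?thesis
    by (intro exI[of _ "\<lambda>p. c p / 4"]) (simp add: sum_divide_distrib[symmetric] mult.commute)
qed

text \<open>Coefficients chosen separately for each \<open>A\<close> need not be linear in
  \<open>A\<close>. They are chosen only for the finitely many \<open>G i j\<close> and extended by
  the identity that the sum of \<open>A $ i $ j *\<^sub>R G i j\<close> is twice \<open>A\<close>,
  valid for skew \<open>A\<close> with zero row sums. Linearity later yields degree -1 in the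
  masses.\<close>

lemma skew_form_expansion:
  obtains K :: "'n square_matrix \<Rightarrow> 'n \<times> 'n \<Rightarrow> real"
  where "\<And>p. linear (\<lambda>A. K A p)"
    and "\<And>A z. transpose A = - A \<Longrightarrow> A *v 1 = 0 \<Longrightarrow>
      fst z \<bullet> (A ** snd z) = (\<Sum>p\<in>pairs'. K A p * \<delta> z p)"
proof -
  fix b :: 'n
  define G :: "'n \<Rightarrow> 'n \<Rightarrow> 'n square_matrix" where
    "G i j = outer_product (edge i b) (edge j b) - outer_product (edge j b) (edge i b)" for i j
  have "transpose (G i j) = - G i j" "G i j *v 1 = 0" for i j
    by (simp_all add: G_def transpose_diff transpose_outer_product outer_product_edge_one
        matrix_vector_mult_diff_rdistrib)
  then have "\<exists>c. \<forall>z. fst z \<bullet> (G i j ** snd z) = (\<Sum>p\<in>pairs'. c p * \<delta> z p)" for i j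
    by (rule skew_form_in_delta)
  then obtain c where c: "\<And>i j z. fst z \<bullet> (G i j ** snd z) = (\<Sum>p\<in>pairs'. c i j p * \<delta> z p)"
    by metis
  define K where "K A p = (\<Sum>i\<in>UNIV. \<Sum>j\<in>UNIV. A $ i $ j / 2 * c i j p)" for A p
  have "linear (\<lambda>A. K A p)" for p
    by (intro linearI) (simp_all add: K_def add_divide_distrib distrib_right sum.distrib
        sum_distrib_left mult.assoc)
  moreover have "fst z \<bullet> (A ** snd z) = (\<Sum>p\<in>pairs'. K A p * \<delta> z p)"
    if A: "transpose A = - A" "A *v 1 = 0" for A and z :: "('d, 'n) phase"
  proof -
    have skew: "A $ j $ i = - A $ i $ j" for i j
      using arg_cong[OF A(1), of "\<lambda>M. M $ i $ j"] by (simp add: transpose_def)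
    have row: "(\<Sum>j\<in>UNIV. A $ i $ j) = 0" for i
      using A(2) by (simp add: vec_eq_iff matrix_vector_mult_def)
    have col: "(\<Sum>j\<in>UNIV. A $ j $ i) = 0" for i
      using row[of i] by (subst skew) (simp add: sum_negf)
    let ?x = "fst z" and ?y = "snd z"
    have 1: "(\<Sum>i\<in>UNIV. \<Sum>j\<in>UNIV. A $ i $ j * h i) = 0" for h
      by (simp add: sum_distrib_right[symmetric] row)
    have 2: "(\<Sum>i\<in>UNIV. \<Sum>j\<in>UNIV. A $ i $ j * h j) = 0" for h
      by (subst sum.swap) (simp add: sum_distrib_right[symmetric] col)
    have 3: "(\<Sum>i\<in>UNIV. \<Sum>j\<in>UNIV. A $ i $ j * (?x $ j \<bullet> ?y $ i)) = - (?x \<bullet> (A ** ?y))"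
      unfolding inner_matrix_mult by (subst sum.swap, subst skew) (simp add: sum_negf)
    \<comment> \<open>The terms containing \<open>b\<close> multiply \<open>A $ i $ j\<close> by a
      function of \<open>i\<close> alone or of \<open>j\<close> alone and vanish; the other two each
      contribute \<open>?x \<bullet> (A ** ?y)\<close>.\<close>
    have "(\<Sum>i\<in>UNIV. \<Sum>j\<in>UNIV. A $ i $ j * (?x \<bullet> (G i j ** ?y))) =
      (\<Sum>i\<in>UNIV. \<Sum>j\<in>UNIV. A $ i $ j * (?x $ i \<bullet> ?y $ j) - A $ i $ j * (?x $ j \<bullet> ?y $ i)
        + A $ i $ j * (?x $ b \<bullet> ?y $ i - ?x $ i \<bullet> ?y $ b)
        + A $ i $ j * (?x $ j \<bullet> ?y $ b - ?x $ b \<bullet> ?y $ j))"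
      by (intro sum.cong refl)
        (simp add: G_def matrix_mult_diff_left inner_diff_right inner_outer_product_edge
          inner_diff_left algebra_simps)
    also have "\<dots> = 2 * (?x \<bullet> (A ** ?y))"
      unfolding sum.distrib sum_subtractf 1 2 3 inner_matrix_mult[symmetric] by simp
    finally have "?x \<bullet> (A ** ?y) = (\<Sum>i\<in>UNIV. \<Sum>j\<in>UNIV. A $ i $ j / 2 * (?x \<bullet> (G i j ** ?y)))"
      by (simp add: sum_divide_distrib[symmetric])
    also have "\<dots> = (\<Sum>i\<in>UNIV. \<Sum>j\<in>UNIV. \<Sum>p\<in>pairs'. A $ i $ j / 2 * c i j p * \<delta> z p)"
      by (simp add: c sum_distrib_left mult.assoc)
    also have "\<dots> = (\<Sum>i\<in>UNIV. \<Sum>p\<in>pairs'. \<Sum>j\<in>UNIV. A $ i $ j / 2 * c i j p * \<delta> z p)"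
      by (intro sum.cong refl sum.swap)
    also have "\<dots> = (\<Sum>p\<in>pairs'. \<Sum>i\<in>UNIV. \<Sum>j\<in>UNIV. A $ i $ j / 2 * c i j p * \<delta> z p)"
      by (rule sum.swap)
    also have "\<dots> = (\<Sum>p\<in>pairs'. K A p * \<delta> z p)"
      by (simp add: K_def sum_distrib_right)
    finally show ?thesis .
  qed
  ultimately show thesis by (rule that)
qed

end

section \<open>The structure matrix\<close>

text \<open>\<open>mass_inverse m\<close> is the sum of the diagonal matrix units weighted by
  \<open>1 / m $ a\<close>, so a linear functional of it is a combination of these
  monomials.\<close>

lemma mass_homogeneous_linear:
  fixes f :: "'n::finite square_matrix \<Rightarrow> real"
  assumes "linear f"
  shows "mass_homogeneous (-1) (\<lambda>m. f (mass_inverse m))"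
proof -
  \<comment> \<open>\<open>u a\<close> is the exponent vector of \<open>1 / m $ a\<close>;
    injectivity lets the sum over exponent vectors be indexed by bodies.\<close>
  define u :: "'n \<Rightarrow> 'n \<Rightarrow> int" where "u a i = (if i = a then -1 else 0)" for a i
  define P :: "'n \<Rightarrow> 'n square_matrix" where "P a = axis a (axis a 1)" for a
  have "inj u"
    by (intro injI) (metis u_def zero_neq_neg_one)
  have monomial: "(\<Prod>i\<in>UNIV. m $ i powi u a i) = 1 / m $ a" for a and m :: "real^'n"
    by (simp add: u_def if_distrib[of "\<lambda>k. _ powi k"] power_int_minus divide_inverse cong: if_cong)
  have D: "mass_inverse m = (\<Sum>a\<in>UNIV. (1 / m $ a) *\<^sub>R P a)" for m :: "real^'n"
    by (auto simp: vec_eq_iff mass_inverse_def P_def axis_def if_distrib[of "\<lambda>v. v $ _"] 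
        if_distrib[of "\<lambda>x. _ * x"] if_distrib[of "\<lambda>x. x / _"] cong: if_cong)
  have "f (mass_inverse m) = (\<Sum>e\<in>range u. f (P (inv u e)) * (\<Prod>i\<in>UNIV. m $ i powi e i))"
    for m :: "real^'n"
    using \<open>inj u\<close> linear_cmul[OF assms] by (simp add: sum.reindex monomial D linear_sum[OF assms])
  moreover have "(\<Sum>i\<in>UNIV. u a i) = -1" for a
    by (simp add: u_def)
  ultimately show ?thesis
    unfolding mass_homogeneous_def
    by (intro exI[of _ "range u"] exI[of _ "\<lambda>e. f (P (inv u e))"]) auto
qed

lemma linear_matrixI:
  fixes c :: "'p \<Rightarrow> 'p \<Rightarrow> 'p \<Rightarrow> 'n::finite square_matrix \<Rightarrow> real"
  assumes "\<And>p q r. linear (c p q r)"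
  shows "linear_matrix R C S (\<lambda>m x p q. \<Sum>r\<in>S. c p q r (mass_inverse m) * x r)"
  unfolding linear_matrix_def
  by (intro exI[of _ "\<lambda>m p q r. c p q r (mass_inverse m)"]) (simp add: mass_homogeneous_linear assms)

theorem theorem5:
  fixes \<delta> :: "('d::finite, 'n::{finite,linorder}) phase \<Rightarrow> 'n \<times> 'n \<Rightarrow> real"
  assumes "CARD('n) \<ge> 2"
    and "admissible_delta \<delta>"
  shows "\<exists>(L :: real^'n::{finite,linorder} \<Rightarrow> ('n \<times> 'n \<Rightarrow> real) \<Rightarrow> 'n \<times> 'n \<Rightarrow> 'n \<times> 'n \<Rightarrow> real) v \<Delta> S.
     linear_matrix pairs pairs pairs L \<and>
     linear_matrix pairs pairs' pairs v \<and>
     linear_matrix pairs pairs pairs' \<Delta> \<and>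
     linear_matrix pairs' pairs' pairs' S \<and>
     (\<forall>m x. symmetric_on pairs (L m x)) \<and>
     (\<forall>m x. antisymmetric_on pairs (\<Delta> m x)) \<and>
     (\<forall>m x. antisymmetric_on pairs' (S m x)) \<and>
     (\<forall>m z. admissible_masses m \<longrightarrow>
        (\<forall>a\<in>indices. \<forall>b\<in>indices.
           structure_matrix m \<delta> z a b =
           block_matrix (L m) (v m) (\<Delta> m) (S m) (rho z) (nu z) (sig z) (\<delta> z) a b))"
proof -
  obtain KA :: "'n square_matrix \<Rightarrow> 'n \<times> 'n \<Rightarrow> real" where lin_KA: "\<And>p. linear (\<lambda>A. KA A p)"
    and KA: "\<And>A z. transpose A = - A \<Longrightarrow> A *v 1 = 0 \<Longrightarrow>
      fst z \<bullet> (A ** snd z) = (\<Sum>p\<in>pairs'. KA A p * \<delta> z p)"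
    using skew_form_expansion[OF assms(2)] by blast
  define KS :: "'n square_matrix \<Rightarrow> 'n \<times> 'n \<Rightarrow> real" where "KS A p = - A $ fst p $ snd p" for A p
  have lin_KS: "linear (\<lambda>A. KS A p)" for p
    by (intro linearI) (simp_all add: KS_def)
  have KS: "x \<bullet> (A ** y) = (\<Sum>p\<in>pairs. KS A p * ((x $ fst p - x $ snd p) \<bullet> (y $ fst p - y $ snd p)))"
    if "transpose A = A" "A *v 1 = 0" for A and x y :: "('d, 'n) configuration"
    using inner_symmetric_expansion[OF that] by (simp add: KS_def split_def)
  have "\<forall>p\<in>pairs'. \<exists>W. transpose W = - W \<and> W *v 1 = 0 \<and> (\<lambda>z. \<delta> z p) = (\<lambda>z. fst z \<bullet> (W ** snd z))"
    using assms(2) by (intro ballI skew_form_matrix) (simp add: admissible_delta_def)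
  from bchoice[OF this] obtain W where W_all: "\<forall>p\<in>pairs'. transpose (W p) = - W p \<and> W p *v 1 = 0 \<and>
      (\<lambda>z. \<delta> z p) = (\<lambda>z. fst z \<bullet> (W p ** snd z))"
    by (elim exE)
  note W = bspec[OF W_all, THEN conjunct1] bspec[OF W_all, THEN conjunct2, THEN conjunct1]
    bspec[OF W_all, THEN conjunct2, THEN conjunct2]
  let ?E = "edge_matrix :: 'n \<times> 'n \<Rightarrow> 'n square_matrix"
  have rho: "(\<lambda>z :: ('d, 'n) phase. rho z p) = (\<lambda>z. fst z \<bullet> (?E p ** fst z))" for p
    by (simp add: fun_eq_iff rho_def edge_matrix_def inner_outer_product_edge split_def qdiff_def
        power2_norm_eq_inner)
  have nu: "(\<lambda>z :: ('d, 'n) phase. nu z p) = (\<lambda>z. snd z \<bullet> (?E p ** snd z))" for p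
    by (simp add: fun_eq_iff nu_def edge_matrix_def inner_outer_product_edge split_def vdiff_def
        power2_norm_eq_inner)
  have sig: "(\<lambda>z :: ('d, 'n) phase. sig z p) = (\<lambda>z. fst z \<bullet> (?E p ** snd z))" for p
    by (simp add: fun_eq_iff sig_def edge_matrix_def inner_outer_product_edge split_def qdiff_def
        vdiff_def)
  \<comment> \<open>One set of coefficients serves all three kinds of forms, so the same
    \<open>L\<close> and \<open>v\<close> recur with the arguments \<rho>, \<nu> and
    \<sigma>.\<close>
  have KS_rho: "fst z \<bullet> (A ** fst z) = (\<Sum>p\<in>pairs. KS A p * rho z p)"
    and KS_nu: "snd z \<bullet> (A ** snd z) = (\<Sum>p\<in>pairs. KS A p * nu z p)"
    and KS_sig: "fst z \<bullet> (A ** snd z) = (\<Sum>p\<in>pairs. KS A p * sig z p)"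
    if "transpose A = A" "A *v 1 = 0" for A and z :: "('d, 'n) phase"
    by (simp_all add: KS[OF that] rho_def nu_def sig_def qdiff_def vdiff_def split_def
        power2_norm_eq_inner)

  define cL where "cL p q D = ?E p ** D ** ?E q + ?E q ** D ** ?E p" for p q D
  define cv where "cv p q D = W q ** D ** ?E p - ?E p ** D ** W q" for p q D
  define cD where "cD p q D = ?E q ** D ** ?E p - ?E p ** D ** ?E q" for p q D
  define cS where "cS p q D = W q ** D ** W p - W p ** D ** W q" for p q D
  \<comment> \<open>Composed with the linear \<open>KS\<close> and \<open>KA\<close>, linearity in
    \<open>D\<close> is what \<open>linear_matrixI\<close> turns into degree -1 in the
    masses.\<close>
  have lin_c: "linear (cL p q)" "linear (cv p q)" "linear (cD p q)" "linear (cS p q)" for p q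
    by (intro linearI; simp add: cL_def cv_def cD_def cS_def matrix_mult_add_left
        matrix_mult_add_right matrix_mult_scaleR_left matrix_mult_scaleR_right algebra_simps)+
  have lin: "linear (\<lambda>D. KS (cL p q D) r)" "linear (\<lambda>D. KS (cv p q D) r)"
    "linear (\<lambda>D. KA (cD p q D) r)" "linear (\<lambda>D. KA (cS p q D) r)" for p q r
    by (rule linear_compose[OF _ lin_KS, unfolded o_def] linear_compose[OF _ lin_KA, unfolded o_def],
        rule lin_c)+
  define L where "L m x p q = (\<Sum>r\<in>pairs. KS (cL p q (mass_inverse m)) r * x r)" for m x p q
  define v where "v m x p q = (\<Sum>r\<in>pairs. KS (cv p q (mass_inverse m)) r * x r)" for m x p q
  define \<Delta> where "\<Delta> m x p q = (\<Sum>r\<in>pairs'. KA (cD p q (mass_inverse m)) r * x r)" for m x p q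
  define S where "S m x p q = (\<Sum>r\<in>pairs'. KA (cS p q (mass_inverse m)) r * x r)" for m x p q
  have "linear_matrix pairs pairs pairs L" "linear_matrix pairs pairs' pairs v"
    "linear_matrix pairs pairs pairs' \<Delta>" "linear_matrix pairs' pairs' pairs' S"
    unfolding L_def[abs_def] v_def[abs_def] \<Delta>_def[abs_def] S_def[abs_def]
    by (intro linear_matrixI lin)+
  \<comment> \<open>Exchanging \<open>p\<close> and \<open>q\<close> preserves \<open>cL\<close> and
    negates \<open>cD\<close> and \<open>cS\<close>, so the symmetries hold for every argument
    \<open>x\<close>, not only for values of the invariants.\<close>
  moreover have L_sym: "L m x q p = L m x p q" for m x p q
    by (simp add: L_def cL_def add.commute)
  moreover have KA_minus: "KA (- A) r = - KA A r" for A r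
    using linear_neg[OF lin_KA] .
  have D_skew: "\<Delta> m x q p = - \<Delta> m x p q" for m x p q
    using KA_minus[of "cD p q (mass_inverse m)"] by (simp add: \<Delta>_def cD_def sum_negf[symmetric])
  have S_skew: "S m x q p = - S m x p q" for m x p q
    using KA_minus[of "cS p q (mass_inverse m)"] by (simp add: S_def cS_def sum_negf[symmetric])
  \<comment> \<open>Every product below ends in an edge matrix or in some \<open>W p\<close>, so its
    row sums vanish.\<close>
  have prod_one: "A ** B ** C *v 1 = 0" if "C *v 1 = 0" for A B C :: "'n square_matrix"
    using that by (simp add: matrix_vector_mul_assoc[symmetric])
  note mat_simps = transpose_add transpose_diff matrix_transpose_mul matrix_mul_assoc
    matrix_mult_minus_left matrix_mult_minus_right
    matrix_vector_mult_add_rdistrib matrix_vector_mult_diff_rdistrib prod_one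
  have cL: "transpose (cL p q (mass_inverse m)) = cL p q (mass_inverse m)"
      "cL p q (mass_inverse m) *v 1 = 0" for p q m
    by (simp_all add: cL_def mat_simps add.commute)
  have cv: "transpose (cv p q (mass_inverse m)) = cv p q (mass_inverse m)"
      "cv p q (mass_inverse m) *v 1 = 0" if "q \<in> pairs'" for p q m
    using W[OF that] by (simp_all add: cv_def mat_simps)
  have cD: "transpose (cD p q (mass_inverse m)) = - cD p q (mass_inverse m)"
      "cD p q (mass_inverse m) *v 1 = 0" for p q m
    by (simp_all add: cD_def mat_simps)
  have cS: "transpose (cS p q (mass_inverse m)) = - cS p q (mass_inverse m)"
      "cS p q (mass_inverse m) *v 1 = 0" if "p \<in> pairs'" "q \<in> pairs'" for p q m
    using W[OF that(1)] W[OF that(2)] by (simp_all add: cS_def mat_simps)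
  have block: "poisson m (\<lambda>z. rho z p) (\<lambda>z. rho z q) z = 0"
      "poisson m (\<lambda>z. nu z p) (\<lambda>z. nu z q) z = 0"
      "poisson m (\<lambda>z. rho z p) (\<lambda>z. nu z q) z = 2 * (L m (sig z) p q - \<Delta> m (\<delta> z) p q)"
      "poisson m (\<lambda>z. rho z p) (\<lambda>z. sig z q) z = L m (rho z) p q"
      "poisson m (\<lambda>z. nu z p) (\<lambda>z. sig z q) z = - L m (nu z) p q"
      "poisson m (\<lambda>z. sig z p) (\<lambda>z. sig z q) z = \<Delta> m (\<delta> z) p q"
    for m p q and z :: "('d, 'n) phase"
  proof -
    \<comment> \<open>\<open>cL p q D - cD p q D\<close> is twice \<open>?E p ** D ** ?E q\<close>.
      The symmetric part expands in \<sigma>, the skew part in \<delta>, and the factor 4 becomes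
      the 2 of this block.\<close>
    have "4 * (fst z \<bullet> ((?E p ** mass_inverse m ** ?E q) ** snd z)) =
        2 * (fst z \<bullet> (cL p q (mass_inverse m) ** snd z) - fst z \<bullet> (cD p q (mass_inverse m) ** snd z))"
      by (simp add: cL_def cD_def matrix_mult_add_left matrix_mult_diff_left
          inner_add_right inner_diff_right)
    then show "poisson m (\<lambda>z. rho z p) (\<lambda>z. nu z q) z = 2 * (L m (sig z) p q - \<Delta> m (\<delta> z) p q)"
      by (simp add: rho nu poisson_position_velocity KS_sig cL KA cD L_def \<Delta>_def)
  next
    show "poisson m (\<lambda>z. rho z p) (\<lambda>z. sig z q) z = L m (rho z) p q"
      unfolding L_def KS_rho[OF cL, symmetric]
      by (simp add: rho sig poisson_position_mixed cL_def)
    show "poisson m (\<lambda>z. nu z p) (\<lambda>z. sig z q) z = - L m (nu z) p q"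
      unfolding L_def KS_nu[OF cL, symmetric]
      by (simp add: nu sig poisson_velocity_mixed cL_def)
    show "poisson m (\<lambda>z. sig z p) (\<lambda>z. sig z q) z = \<Delta> m (\<delta> z) p q"
      unfolding \<Delta>_def KA[OF cD, symmetric]
      by (simp add: sig poisson_mixed_mixed cD_def)
  qed (simp_all add: rho nu poisson_position_position poisson_velocity_velocity)
  \<comment> \<open>Since \<open>W q\<close> is skew, all three brackets lead to \<open>cv\<close>
    with the same sign, whereas symmetric edge matrices leave the minus sign in -L(\<nu>).\<close>
  have block_delta: "poisson m (\<lambda>z. rho z p) (\<lambda>z. \<delta> z q) z = v m (rho z) p q"
      "poisson m (\<lambda>z. nu z p) (\<lambda>z. \<delta> z q) z = v m (nu z) p q"
      "poisson m (\<lambda>z. sig z p) (\<lambda>z. \<delta> z q) z = v m (sig z) p q"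
    if q: "q \<in> pairs'" for m p q and z :: "('d, 'n) phase"
    unfolding v_def KS_rho[OF cv[OF q], symmetric] KS_nu[OF cv[OF q], symmetric]
      KS_sig[OF cv[OF q], symmetric]
    by (simp_all add: rho nu sig W(3)[OF q] W(1)[OF q] poisson_position_mixed poisson_velocity_mixed
        poisson_mixed_mixed cv_def matrix_mult_minus_left matrix_mult_minus_right
        matrix_mult_diff_left matrix_mult_add_left inner_diff_right inner_add_right)
  have block_delta_delta: "poisson m (\<lambda>z. \<delta> z p) (\<lambda>z. \<delta> z q) z = S m (\<delta> z) p q"
    if "p \<in> pairs'" "q \<in> pairs'" for m p q and z :: "('d, 'n) phase"
    unfolding S_def KA[OF cS[OF that], symmetric]
    by (simp add: W(3)[OF that(1)] W(3)[OF that(2)] poisson_mixed_mixed cS_def)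
  \<comment> \<open>The instances of \<open>poisson_skew\<close> carry the six blocks below the
    diagonal to those above it; fixing the kinds of both arguments makes them rewrite in one
    direction only.\<close>
  have "structure_matrix m \<delta> z a b =
      block_matrix (L m) (v m) (\<Delta> m) (S m) (rho z) (nu z) (sig z) (\<delta> z) a b"
    if ab: "a \<in> indices" "b \<in> indices" for m a b z
    using ab
    by (cases a; cases b)
      (auto simp: indices_def structure_matrix_def block block_delta block_delta_delta
        poisson_skew[of m "\<lambda>z. nu z _" "\<lambda>z. rho z _"]
        poisson_skew[of m "\<lambda>z. sig z _" "\<lambda>z. rho z _"]
        poisson_skew[of m "\<lambda>z. sig z _" "\<lambda>z. nu z _"]
        poisson_skew[of m "\<lambda>z. \<delta> z _" "\<lambda>z. rho z _"]
        poisson_skew[of m "\<lambda>z. \<delta> z _" "\<lambda>z. nu z _"]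
        poisson_skew[of m "\<lambda>z. \<delta> z _" "\<lambda>z. sig z _"])
  ultimately show ?thesis
    using D_skew S_skew unfolding symmetric_on_def antisymmetric_on_def by blast
qed

end
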